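(* Let $\mathfrak{G}=(\mathcal{D},\mathcal{B})$ be an mDAG whose simplicial complex contains a sequence of faces $C_i\in\mathcal{B}$, $i=1,\dots,n$ (not necessarily disjoint from each other), and a face $D\in\mathcal{B}$ that is disjoint from every $C_i$, $i=1,\dots,n$. Let $\mathfrak{G}'$ be the mDAG obtained from $\mathfrak{G}$ by adding to its simplicial complex (if not already present) the sets $B_i=C_i\cup D$, $i=1,\dots,n$, together with all of the faces they contain (the directed structure being unchanged). Suppose that: 1. $\mathrm{pa}_{\mathcal{D}}(C_i)\cup C_i\subseteq \mathrm{pa}_{\mathcal{D}}(d)$ for each $d\in D$ and each $i=1,\dots,n$; 2. for every facet $B'$ of $\mathcal{B}$ such that $B'\not\subseteq C_i$ for all $i=1,\dots,n$, if $c\in B'$ for some $c\in\bigcup_{i=1}^n C_i$, then $D\subseteq B'$. Then $\mathfrak{G}$ observationally dominates $\mathfrak{G}'$, i.e. $\mathfrak{G}\succeq\mathfrak{G}'$; and hence (since $\mathfrak{G}'$ structurally, and therefore observationally, dominates $\mathfrak{G}$) $\mathfrak{G}$ and $\mathfrak{G}'$ are observationally equivalent, $\mathfrak{G}\cong\mathfrak{G}'$.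
   Context: A pDAG $\mathcal{G}$ is a finite directed acyclic graph (DAG) whose nodes are partitioned into visible nodes $V$ and latent nodes $L$. Let $\mathrm{pa}_{\mathcal{G}}(a)$ denote the set of parents of node $a$, and $\mathrm{pa}_{\mathcal{G}}(S)=\bigcup_{a\in S}\mathrm{pa}_{\mathcal{G}}(a)$. For a vector $\vec c\in\mathbb{N}^{V}$ of (positive) cardinalities, $\mathcal{M}(\mathcal{G},\vec c)$ is the set of all probability distributions $P$ of $(X_v)_{v\in V}$, where $X_v$ takes values in a fixed set of size $c_v$, that can be written $$P(X_V)=\sum_{X_L}\sum_{E}\ \prod_{a\in V\cup L}\delta_{X_a,\,f_a(X_{\mathrm{pa}_{\mathcal{G}}(a)},E_a)}\,P(E_a)$$ for some choice of finite state spaces of arbitrary size for the latent variables $X_l$ ($l\in L$), of finite error variables $E_a$ with distributions $P(E_a)$ (one for each node $a$), and of functions $f_a$. An mDAG is a pair $\mathfrak{G}=(\mathcal{D},\mathcal{B})$, where $\mathcal{D}$ is a DAG (the directed structure) and $\mathcal{B}$ is a simplicial complex over the nodes of $\mathcal{D}$: a set of subsets of the node set that contains all singletons and is closed under taking subsets. Elements of $\mathcal{B}$ are faces; inclusion-maximal elements are facets. The canonical pDAG $\mathrm{can}(\mathfrak{G})$ has as visible nodes the nodes of $\mathcal{D}$, all edges of $\mathcal{D}$, and in addition, for each facet $A$ of $\mathcal{B}$, one parentless latent node whose set of children is exactly $A$. Put $\mathcal{M}(\mathfrak{G},\vec c)=\mathcal{M}(\mathrm{can}(\mathfrak{G}),\vec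 c)$. For two mDAGs with the same nodes, $\mathfrak{G}$ observationally dominates $\mathfrak{G}'$ ($\mathfrak{G}\succeq\mathfrak{G}'$) if $\mathcal{M}(\mathfrak{G}',\vec c)\subseteq\mathcal{M}(\mathfrak{G},\vec c)$ for every $\vec c$; they are observationally equivalent ($\mathfrak{G}\cong\mathfrak{G}'$) if equality holds for every $\vec c$. $\mathfrak{G}=(\mathcal D,\mathcal B)$ structurally dominates $\mathfrak{G}'=(\mathcal D',\mathcal B')$ if every edge of $\mathcal{D}'$ is an edge of $\mathcal{D}$ and $\mathcal{B}'\subseteq\mathcal{B}$; structural dominance implies observational dominance. *)

theory Defs
  imports "Graph_Theory.Pair_Digraph" "HOL-Probability.Probability_Mass_Function"
begin

definition dag :: "'a pair_pre_digraph \<Rightarrow> bool" where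
  "dag G \<longleftrightarrow> pair_fin_digraph G \<and> acyclic (parcs G)"

definition parents :: "'a pair_pre_digraph \<Rightarrow> 'a \<Rightarrow> 'a set" where
  "parents G a = {b. (b, a) \<in> parcs G}"

definition parents_of :: "'a pair_pre_digraph \<Rightarrow> 'a set \<Rightarrow> 'a set" where
  "parents_of G S = (\<Union>a\<in>S. parents G a)"

text \<open>
  A pDAG is a DAG over a sum type: \<^term>\<open>Inl v\<close> is a visible node and \<^term>\<open>Inr l\<close> a latent
  one, so that the partition of the nodes is carried by the type. Distributions of the visible
  variables are then indexed by the visible labels alone, and can be compared between pDAGs whose
  latent nodes differ.
\<close>

type_synonym ('v, 'l) pdag = "('v + 'l) pair_pre_digraph"

definition visible :: "('v, 'l) pdag \<Rightarrow> 'v set" where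
  "visible G = Inl -` pverts G"

definition latent :: "('v, 'l) pdag \<Rightarrow> 'l set" where
  "latent G = Inr -` pverts G"

text \<open>
  Assignments of values to a set \<open>S\<close> of nodes are functions in \<^term>\<open>PiE S T\<close>, i.e. they are
  \<^term>\<open>undefined\<close> outside \<open>S\<close>.
\<close>

definition assignments :: "'a set \<Rightarrow> ('a \<Rightarrow> nat) \<Rightarrow> ('a \<Rightarrow> nat) set" where
  "assignments S c = (\<Pi>\<^sub>E a\<in>S. {..<c a})"

text \<open>
  In \<open>pdag_model G c\<close>, the vector \<open>c\<close> holds the cardinalities of the visible variables, \<open>k\<close> those
  of the latent variables, \<open>m\<close> those of the error variables, and \<open>q a\<close> is the distribution of the
  error variable of node \<open>a\<close>. The function \<open>f a\<close> receives the values of the parents of \<open>a\<close> only.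
\<close>

definition pdag_model :: "('v, 'l) pdag \<Rightarrow> ('v \<Rightarrow> nat) \<Rightarrow> ('v \<Rightarrow> nat) pmf set" where
  "pdag_model G c =
    {P. set_pmf P \<subseteq> assignments (visible G) c \<and>
        (\<exists>(k :: 'l \<Rightarrow> nat) (m :: 'v + 'l \<Rightarrow> nat) (q :: 'v + 'l \<Rightarrow> nat pmf)
          (f :: 'v + 'l \<Rightarrow> ('v + 'l \<Rightarrow> nat) \<Rightarrow> nat \<Rightarrow> nat).
          (\<forall>a\<in>pverts G. set_pmf (q a) \<subseteq> {..<m a}) \<and>
          (\<forall>a\<in>pverts G. \<forall>y\<in>assignments (parents G a) (case_sum c k). \<forall>e<m a.
              f a y e < case_sum c k a) \<and>
          (\<forall>x\<in>assignments (visible G) c.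
              pmf P x =
                (\<Sum>u\<in>assignments (latent G) k. \<Sum>e\<in>assignments (pverts G) m.
                  \<Prod>a\<in>pverts G.
                    of_bool (case_sum x u a = f a (restrict (case_sum x u) (parents G a)) (e a))
                      * pmf (q a) (e a))))}"

definition simplicial_complex :: "'a set \<Rightarrow> 'a set set \<Rightarrow> bool" where
  "simplicial_complex V B \<longleftrightarrow>
    (\<forall>A\<in>B. A \<subseteq> V) \<and> (\<forall>v\<in>V. {v} \<in> B) \<and> (\<forall>A\<in>B. \<forall>A'. A' \<subseteq> A \<longrightarrow> A' \<in> B)"

definition facets :: "'a set set \<Rightarrow> 'a set set" where
  "facets B = {A \<in> B. \<forall>A'\<in>B. A \<subseteq> A' \<longrightarrow> A' = A}"

record 'a mdag =
  dstruct :: "'a pair_pre_digraph"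
  faces :: "'a set set"

definition is_mdag :: "'a mdag \<Rightarrow> bool" where
  "is_mdag \<GG> \<longleftrightarrow> dag (dstruct \<GG>) \<and> simplicial_complex (pverts (dstruct \<GG>)) (faces \<GG>)"

text \<open>The latent node belonging to a facet is labelled by that facet.\<close>

definition can :: "'a mdag \<Rightarrow> ('a, 'a set) pdag" where
  "can \<GG> =
    \<lparr> pverts = pverts (dstruct \<GG>) <+> facets (faces \<GG>),
      parcs = {(Inl a, Inl b) | a b. (a, b) \<in> parcs (dstruct \<GG>)} \<union>
              {(Inr A, Inl a) | A a. A \<in> facets (faces \<GG>) \<and> a \<in> A} \<rparr>"

definition mdag_model :: "'a mdag \<Rightarrow> ('a \<Rightarrow> nat) \<Rightarrow> ('a \<Rightarrow> nat) pmf set" where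
  "mdag_model \<GG> c = pdag_model (can \<GG>) c"

definition obs_dominates :: "'a mdag \<Rightarrow> 'a mdag \<Rightarrow> bool" (infix "\<succeq>" 50) where
  "\<GG> \<succeq> \<GG>' \<longleftrightarrow>
    pverts (dstruct \<GG>) = pverts (dstruct \<GG>') \<and>
    (\<forall>c. (\<forall>v\<in>pverts (dstruct \<GG>). 0 < c v) \<longrightarrow> mdag_model \<GG>' c \<subseteq> mdag_model \<GG> c)"

definition obs_equivalent :: "'a mdag \<Rightarrow> 'a mdag \<Rightarrow> bool" (infix "\<cong>\<^sub>o" 50) where
  "\<GG> \<cong>\<^sub>o \<GG>' \<longleftrightarrow>
    pverts (dstruct \<GG>) = pverts (dstruct \<GG>') \<and>
    (\<forall>c. (\<forall>v\<in>pverts (dstruct \<GG>). 0 < c v) \<longrightarrow> mdag_model \<GG> c = mdag_model \<GG>' c)"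

definition struct_dominates :: "'a mdag \<Rightarrow> 'a mdag \<Rightarrow> bool" where
  "struct_dominates \<GG> \<GG>' \<longleftrightarrow>
    pverts (dstruct \<GG>) = pverts (dstruct \<GG>') \<and>
    parcs (dstruct \<GG>') \<subseteq> parcs (dstruct \<GG>) \<and> faces \<GG>' \<subseteq> faces \<GG>"

definition add_faces :: "'a mdag \<Rightarrow> 'a set set \<Rightarrow> 'a mdag" where
  "add_faces \<GG> \<A> = \<GG>\<lparr>faces := faces \<GG> \<union> (\<Union>A\<in>\<A>. Pow A)\<rparr>"

lemma dag_can:
  assumes "is_mdag \<GG>"
  shows "dag (can \<GG>)"
proof -
  let ?D = "dstruct \<GG>"
  let ?E = "parcs (can \<GG>)"
  have fin: "pair_fin_digraph ?D" and ac: "acyclic (parcs ?D)"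
    and sub: "\<forall>A\<in>faces \<GG>. A \<subseteq> pverts ?D"
    using assms by (auto simp: is_mdag_def dag_def simplicial_complex_def)
  interpret pair_fin_digraph ?D by (fact fin)
  have "faces \<GG> \<subseteq> Pow (pverts ?D)" using sub by auto
  then have "finite (facets (faces \<GG>))"
    unfolding facets_def using pair_finite_verts by (simp add: finite_subset)
  then have finV: "finite (pverts (can \<GG>))"
    using pair_finite_verts by (simp add: can_def)
  have subE: "?E \<subseteq> pverts (can \<GG>) \<times> pverts (can \<GG>)"
    using sub by (auto simp: can_def facets_def dest: arc_fst_in_verts arc_snd_in_verts)
  have "finite ?E"
    using finite_subset[OF subE] finV by simp
  then have 1: "pair_fin_digraph (can \<GG>)"
    using finV by (intro pair_fin_digraph.intro pair_wf_digraph.intro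
      pair_fin_digraph_axioms.intro) (use subE in auto)
  have step: "\<exists>b'. b = Inl b' \<and> (\<forall>a'. a = Inl a' \<longrightarrow> (a', b') \<in> (parcs ?D)\<^sup>+)"
    if "(a, b) \<in> ?E\<^sup>+" for a b
    using that
  proof (induction rule: trancl_induct)
    case (base b)
    then show ?case by (auto simp: can_def)
  next
    case (step b c)
    then obtain b' where b': "b = Inl b'" "\<forall>a'. a = Inl a' \<longrightarrow> (a', b') \<in> (parcs ?D)\<^sup>+"
      by blast
    with step obtain c' where "c = Inl c'" "(b', c') \<in> parcs ?D"
      by (auto simp: can_def)
    with b' show ?case by (auto intro: trancl_into_trancl)
  qed
  have "acyclic ?E"
    using step ac unfolding acyclic_def by blast
  with 1 show ?thesis by (simp add: dag_def)
qed

lemma is_mdag_add_faces: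
  assumes "is_mdag \<GG>" and "\<And>A. A \<in> \<A> \<Longrightarrow> A \<subseteq> pverts (dstruct \<GG>)"
  shows "is_mdag (add_faces \<GG> \<A>)"
proof -
  have "simplicial_complex (pverts (dstruct \<GG>)) (faces \<GG> \<union> (\<Union>A\<in>\<A>. Pow A))"
    unfolding simplicial_complex_def
  proof (intro conjI ballI allI impI)
    fix A assume "A \<in> faces \<GG> \<union> (\<Union>A\<in>\<A>. Pow A)"
    then show "A \<subseteq> pverts (dstruct \<GG>)"
      using assms(1) assms(2) by (fastforce simp: is_mdag_def simplicial_complex_def)
  next
    fix v assume "v \<in> pverts (dstruct \<GG>)"
    then show "{v} \<in> faces \<GG> \<union> (\<Union>A\<in>\<A>. Pow A)"
      using assms(1) by (simp add: is_mdag_def simplicial_complex_def)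
  next
    fix A A' assume "A \<in> faces \<GG> \<union> (\<Union>A\<in>\<A>. Pow A)" and "A' \<subseteq> A"
    moreover have "\<forall>A\<in>faces \<GG>. \<forall>A'. A' \<subseteq> A \<longrightarrow> A' \<in> faces \<GG>"
      using assms(1) by (simp add: is_mdag_def simplicial_complex_def)
    ultimately show "A' \<in> faces \<GG> \<union> (\<Union>A\<in>\<A>. Pow A)"
      by blast
  qed
  then show ?thesis
    using assms(1) by (simp add: is_mdag_def add_faces_def)
qed

end

theory Submission
  imports Defs "HOL-Probability.Product_PMF"
begin

text \<open>
  Let \<open>\<mu>\<close> be the latent variables that belong to the new facets \<open>C\<^sub>i \<union> D\<close>. Their part in the joint
  distribution is \<open>E\<^sub>\<mu>[h(\<mu>) B(\<mu>)]\<close>, where \<open>h\<close> is the product of the kernels of the nodes in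
  \<open>C = \<Union>C\<^sub>i\<close> and \<open>B\<close> that of the nodes in \<open>D\<close>. It is also \<open>E\<^sub>\<mu>[h(\<mu>)] E\<^sub>r[B]\<close>, where the posterior
  distribution \<open>r\<close> of \<open>\<mu>\<close> has a density proportional to \<open>h\<close>, so \<open>D\<close> may use a fresh sample of the
  posterior instead of \<open>\<mu>\<close>. The function \<open>h\<close> depends on the values of \<open>C\<close> and of its parents, all of
  which are parents of each node in \<open>D\<close> by the first condition, and on the other latent variables
  that influence \<open>C\<close>, to which each node in \<open>D\<close> has access by the second condition. As \<open>D\<close> is a face,
  its nodes can share the randomness for the sample, and \<open>\<mu>\<close> itself is only needed by the faces \<open>C\<^sub>i\<close>.
\<close>

section \<open>Finitely supported product distributions\<close>

lemma finite_set_Pi_pmf: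
  assumes "finite A" and "\<And>x. x \<in> A \<Longrightarrow> finite (set_pmf (p x))"
  shows "finite (set_pmf (Pi_pmf A dflt p))"
  using assms by (auto simp: set_Pi_pmf)

lemma expectation_pair_pmf_finite:
  fixes h :: "'a \<times> 'b \<Rightarrow> real"
  assumes "finite (set_pmf p)" and "finite (set_pmf q)"
  shows "measure_pmf.expectation (pair_pmf p q) h =
    measure_pmf.expectation p (\<lambda>x. measure_pmf.expectation q (\<lambda>y. h (x, y)))"
proof -
  have "measure_pmf.expectation (pair_pmf p q) h =
      (\<Sum>a\<in>set_pmf p. \<Sum>b\<in>set_pmf q. h (a, b) * pmf (pair_pmf p q) (a, b))"
    using assms by (subst integral_measure_pmf_real[where A = "set_pmf p \<times> set_pmf q"])
      (auto simp: sum.cartesian_product)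
  also have "\<dots> = (\<Sum>a\<in>set_pmf p. (\<Sum>b\<in>set_pmf q. h (a, b) * pmf q b) * pmf p a)"
    by (simp add: pmf_pair sum_distrib_left mult_ac)
  also have "\<dots> = measure_pmf.expectation p (\<lambda>x. measure_pmf.expectation q (\<lambda>y. h (x, y)))"
    using assms by (simp add: integral_measure_pmf_real[where A = "set_pmf p"]
      integral_measure_pmf_real[where A = "set_pmf q"])
  finally show ?thesis .
qed

lemma expectation_pair_pmf_finite':
  fixes h :: "'a \<times> 'b \<Rightarrow> real"
  assumes "finite (set_pmf p)" and "finite (set_pmf q)"
  shows "measure_pmf.expectation (pair_pmf p q) h =
    measure_pmf.expectation q (\<lambda>y. measure_pmf.expectation p (\<lambda>x. h (x, y)))"
  by (subst pair_commute_pmf) (simp add: expectation_pair_pmf_finite assms)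

text \<open>Grouping preserves independence: the fibres of \<open>g\<close> partition
  \<open>J\<close>, so independent blocks, one for each fibre, glue to the original product. A point
  of \<open>J'\<close> outside the image of \<open>g\<close> carries an empty block.\<close>

lemma Pi_pmf_fibres:
  assumes "finite J" and "finite J'" and g: "g ` J \<subseteq> J'"
  shows "map_pmf (\<lambda>w j. if j \<in> J then w (g j) j else d)
      (Pi_pmf J' d' (\<lambda>j'. Pi_pmf {j \<in> J. g j = j'} d q)) = Pi_pmf J d q"
    (is "map_pmf ?\<phi> ?M = _")
proof (rule pmf_eqI)
  fix u
  show "pmf (map_pmf ?\<phi> ?M) u = pmf (Pi_pmf J d q) u"
  proof (cases "\<forall>j. j \<notin> J \<longrightarrow> u j = d")
    case False
    then have "u \<notin> set_pmf (map_pmf ?\<phi> ?M)"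
      by auto
    then have "pmf (map_pmf ?\<phi> ?M) u = 0"
      by (simp add: pmf_eq_0_set_pmf)
    with False assms show ?thesis
      by (auto simp: pmf_Pi)
  next
    case True
    \<comment> \<open>The only possible preimage of \<open>u\<close> in the support:
      \<open>u\<close> cut along the fibres, with the defaults elsewhere.\<close>
    define w where "w j' = (if j' \<in> J' then (\<lambda>j. if j \<in> J \<and> g j = j' then u j else d) else d')" for j'
    have inj: "v = w" if v: "v \<in> set_pmf ?M" and "?\<phi> v = u" for v
    proof
      fix j'
      have "v \<in> PiE_dflt J' d' (set_pmf \<circ> (\<lambda>j'. Pi_pmf {j \<in> J. g j = j'} d q))"
        using v assms by (simp add: set_Pi_pmf)
      then have *: "j' \<notin> J' \<Longrightarrow> v j' = d'"
        "j' \<in> J' \<Longrightarrow> v j' \<in> set_pmf (Pi_pmf {j \<in> J. g j = j'} d q)"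
        by (auto simp: PiE_dflt_def)
      show "v j' = w j'"
      proof (cases "j' \<in> J'")
        case True
        then have "\<forall>j. \<not> (j \<in> J \<and> g j = j') \<longrightarrow> v j' j = d"
          using * set_Pi_pmf_subset[of "{j \<in> J. g j = j'}" d q] assms by auto
        moreover have "v j' j = u j" if "j \<in> J" "g j = j'" for j
          using that fun_cong[OF \<open>?\<phi> v = u\<close>, of j] by simp
        ultimately show ?thesis
          using True by (auto simp: w_def fun_eq_iff)
      qed (use * in \<open>simp add: w_def\<close>)
    qed
    have "?\<phi> w = u"
      using g True by (auto simp: w_def fun_eq_iff)
    \<comment> \<open>The preimage of \<open>u\<close> may contain points other than
      \<open>w\<close>, but by \<open>inj\<close> they have probability zero.\<close>
    then have "pmf (map_pmf ?\<phi> ?M) u = measure (measure_pmf ?M) {w}"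
      unfolding pmf_map using inj
      by (intro measure_prob_cong_0) (auto simp: pmf_eq_0_set_pmf)
    also have "\<dots> = (\<Prod>j'\<in>J'. pmf (Pi_pmf {j \<in> J. g j = j'} d q) (w j'))"
      using assms by (simp add: measure_pmf_single pmf_Pi' w_def)
    also have "\<dots> = (\<Prod>j'\<in>J'. \<Prod>j\<in>{j \<in> J. g j = j'}. pmf (q j) (u j))"
      using assms by (intro prod.cong refl) (auto simp: pmf_Pi w_def intro!: prod.cong)
    also have "\<dots> = (\<Prod>j\<in>J. pmf (q j) (u j))"
      using assms by (rule prod.group)
    also have "\<dots> = pmf (Pi_pmf J d q) u"
      using assms True by (simp add: pmf_Pi')
    finally show ?thesis .
  qed
qed

section \<open>Posterior distributions\<close>

text \<open>
  If \<open>E h = 0\<close> the posterior is not determined, and then any distribution will do.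
\<close>

lemma posterior_pmf:
  fixes h :: "'a \<Rightarrow> real"
  assumes fin: "finite (set_pmf p)" and h: "\<And>a. 0 \<le> h a"
  obtains r where "set_pmf r \<subseteq> set_pmf p"
    and "\<And>g. measure_pmf.expectation p h * measure_pmf.expectation r g =
      measure_pmf.expectation p (\<lambda>a. h a * g a :: real)"
proof (cases "measure_pmf.expectation p h = 0")
  case True
  then have "\<forall>a\<in>set_pmf p. h a * pmf p a = 0"
    using fin h by (simp add: integral_measure_pmf_real[where A = "set_pmf p"] sum_nonneg_eq_0_iff)
  then have "measure_pmf.expectation p (\<lambda>a. h a * g a) = 0" for g :: "'a \<Rightarrow> real"
    using fin by (simp add: integral_measure_pmf_real[where A = "set_pmf p"] sum.neutral mult_ac)
  with True show ?thesis
    by (intro that[of p]) auto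
next
  case False
  let ?Z = "measure_pmf.expectation p h"
  have Z: "?Z = (\<Sum>a\<in>set_pmf p. h a * pmf p a)"
    using fin by (simp add: integral_measure_pmf_real[where A = "set_pmf p"])
  have pos: "0 < ?Z"
    using False h by (simp add: less_le)
  \<comment> \<open>Bayes' rule: prior weight times likelihood \<open>h\<close>, normalised by the
    evidence \<open>?Z\<close>.\<close>
  define f where "f a = h a * pmf p a / ?Z" for a
  have nonneg: "0 \<le> f a" for a
    using pos h by (simp add: f_def)
  have supp: "f a \<noteq> 0 \<Longrightarrow> a \<in> set_pmf p" for a
    by (auto simp: f_def set_pmf_eq)
  have "(\<integral>\<^sup>+a. ennreal (f a) \<partial>count_space UNIV) = (\<Sum>a\<in>set_pmf p. ennreal (f a))"
    using supp by (intro nn_integral_count_space'[OF fin]) (auto simp: nonneg)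
  also have "\<dots> = ennreal (\<Sum>a\<in>set_pmf p. f a)"
    by (simp add: nonneg sum_ennreal)
  also have "(\<Sum>a\<in>set_pmf p. f a) = 1"
    using pos by (simp add: f_def Z flip: sum_divide_distrib)
  finally have total: "(\<integral>\<^sup>+a. ennreal (f a) \<partial>count_space UNIV) = 1" by simp
  define r where "r = embed_pmf f"
  have r: "pmf r a = f a" for a
    unfolding r_def using nonneg total by (rule pmf_embed_pmf)
  have sub: "set_pmf r \<subseteq> set_pmf p"
    using supp by (auto simp: set_pmf_eq r)
  show ?thesis
  proof (rule that[OF sub])
    fix g :: "'a \<Rightarrow> real"
    have "?Z * measure_pmf.expectation r g = (\<Sum>a\<in>set_pmf p. ?Z * (g a * f a))"
      using sub fin by (subst (2) integral_measure_pmf_real[where A = "set_pmf p"])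
        (auto simp: r sum_distrib_left)
    also have "\<dots> = (\<Sum>a\<in>set_pmf p. h a * g a * pmf p a)"
      using pos by (intro sum.cong) (auto simp: f_def)
    also have "\<dots> = measure_pmf.expectation p (\<lambda>a. h a * g a)"
      using fin by (simp add: integral_measure_pmf_real[where A = "set_pmf p"])
    finally show "?Z * measure_pmf.expectation r g = measure_pmf.expectation p (\<lambda>a. h a * g a)" .
  qed
qed

section \<open>Kernel representations and changes of their latent variables\<close>

text \<open>
  The latent variables indexed by \<open>J\<close> are independent with distributions \<open>q\<close>, and \<open>v\<close> has access to
  those in \<open>I v\<close>. The error variables are absorbed into the kernels \<open>K\<close>, and the type of the values
  of the latent variables is arbitrary. The value \<open>d\<close> is the one that an assignment takes outside \<open>J\<close>.
\<close>

definition latent_repr ::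
  "'a set \<Rightarrow> ('a \<Rightarrow> 'a set) \<Rightarrow> ('a \<Rightarrow> nat) \<Rightarrow> 'j set \<Rightarrow> ('a \<Rightarrow> 'j set) \<Rightarrow> ('a \<Rightarrow> nat) pmf \<Rightarrow>
    'u \<Rightarrow> ('j \<Rightarrow> 'u pmf) \<Rightarrow> ('a \<Rightarrow> ('a \<Rightarrow> nat) \<Rightarrow> ('j \<Rightarrow> 'u) \<Rightarrow> nat pmf) \<Rightarrow> bool" where
  "latent_repr V pa c J I P d q K \<longleftrightarrow>
    set_pmf P \<subseteq> assignments V c \<and>
    (\<forall>j\<in>J. finite (set_pmf (q j))) \<and>
    (\<forall>v\<in>V. \<forall>x u. set_pmf (K v x u) \<subseteq> {..<c v}) \<and>
    (\<forall>v\<in>V. \<forall>x x' u u'. (\<forall>w\<in>pa v. x w = x' w) \<longrightarrow> (\<forall>j\<in>I v. u j = u' j) \<longrightarrow>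
      K v x u = K v x' u') \<and>
    (\<forall>x\<in>assignments V c.
      pmf P x = measure_pmf.expectation (Pi_pmf J d q) (\<lambda>u. \<Prod>v\<in>V. pmf (K v x u) (x v)))"

lemma latent_repr_local:
  assumes "latent_repr V pa c J I P d q K" and "v \<in> V"
    and "\<And>w. w \<in> pa v \<Longrightarrow> x w = x' w" and "\<And>j. j \<in> I v \<Longrightarrow> u j = u' j"
  shows "K v x u = K v x' u'"
  using assms unfolding latent_repr_def by blast

text \<open>A latent variable can be carried as a component of another one if every node that reads
  \<open>j\<close> may read \<open>g j\<close>. The variable at \<open>j'\<close> becomes the tuple
  of all variables in its fibre, and each node uses only the components it had before.\<close>

lemma latent_repr_reassign:
  assumes rep: "latent_repr V pa c J I P d q K"
    and fin: "finite J" "finite J'"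
    and g: "g ` J \<subseteq> J'"
    and I: "\<And>v. v \<in> V \<Longrightarrow> I v \<subseteq> J" "\<And>v. v \<in> V \<Longrightarrow> g ` I v \<subseteq> I' v"
  shows "latent_repr V pa c J' I' P d' (\<lambda>j'. Pi_pmf {j \<in> J. g j = j'} d q)
    (\<lambda>v x w. K v x (\<lambda>j. w (g j) j))"
  unfolding latent_repr_def
proof (intro conjI ballI allI impI)
  fix j' assume "j' \<in> J'"
  show "finite (set_pmf (Pi_pmf {j \<in> J. g j = j'} d q))"
    using rep fin by (intro finite_set_Pi_pmf) (auto simp: latent_repr_def)
next
  fix v and x x' :: "'a \<Rightarrow> nat" and w w' :: "'d \<Rightarrow> 'b \<Rightarrow> 'c"
  assume "v \<in> V" "\<forall>a\<in>pa v. x a = x' a" "\<forall>j'\<in>I' v. w j' = w' j'"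
  then show "K v x (\<lambda>j. w (g j) j) = K v x' (\<lambda>j. w' (g j) j)"
    using I by (intro latent_repr_local[OF rep]) (auto simp: subset_iff)
next
  fix x assume x: "x \<in> assignments V c"
  have "pmf P x = measure_pmf.expectation (Pi_pmf J d q) (\<lambda>u. \<Prod>v\<in>V. pmf (K v x u) (x v))"
    using rep x by (simp add: latent_repr_def)
  also have "\<dots> = measure_pmf.expectation (Pi_pmf J' d' (\<lambda>j'. Pi_pmf {j \<in> J. g j = j'} d q))
      (\<lambda>w. \<Prod>v\<in>V. pmf (K v x (\<lambda>j. if j \<in> J then w (g j) j else d)) (x v))"
    by (subst Pi_pmf_fibres[OF fin g, of d d' q, symmetric]) simp
  \<comment> \<open>Outside \<open>J\<close> the new argument of \<open>K\<close> may differ from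
    \<open>d\<close>, but the kernel of \<open>v\<close> reads only \<open>I v\<close>, which lies
    in \<open>J\<close>.\<close>
  also have "\<dots> = measure_pmf.expectation (Pi_pmf J' d' (\<lambda>j'. Pi_pmf {j \<in> J. g j = j'} d q))
      (\<lambda>w. \<Prod>v\<in>V. pmf (K v x (\<lambda>j. w (g j) j)) (x v))"
  proof (intro Bochner_Integration.integral_cong refl prod.cong)
    fix v and w :: "'d \<Rightarrow> 'b \<Rightarrow> 'c" assume v: "v \<in> V"
    have "K v x (\<lambda>j. if j \<in> J then w (g j) j else d) = K v x (\<lambda>j. w (g j) j)"
      using I(1)[OF v] by (intro latent_repr_local[OF rep v]) auto
    then show "pmf (K v x (\<lambda>j. if j \<in> J then w (g j) j else d)) (x v) =
        pmf (K v x (\<lambda>j. w (g j) j)) (x v)" by simp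
  qed
  finally show "pmf P x = measure_pmf.expectation (Pi_pmf J' d' (\<lambda>j'. Pi_pmf {j \<in> J. g j = j'} d q))
      (\<lambda>w. \<Prod>v\<in>V. pmf (K v x (\<lambda>j. w (g j) j)) (x v))" .
qed (use rep in \<open>auto simp: latent_repr_def\<close>)

text \<open>
  The latent variables in \<open>M\<close> are made inaccessible to \<open>D\<close>. In their place, the nodes of \<open>D\<close> share a
  new latent variable \<open>j0\<close>: a random function \<open>\<nu>\<close> that maps all that can be observed about \<open>M\<close> without
  access to it to a sample of its posterior distribution.
\<close>

lemma latent_repr_posterior:
  fixes V :: "'a set" and J :: "'j set" and d :: 'u
  assumes rep: "latent_repr V pa c J I P d q K"
    and fin: "finite V" "finite J"
    and I: "\<And>v. v \<in> V \<Longrightarrow> I v \<subseteq> J"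
    and j0: "j0 \<notin> J" and M: "M \<subseteq> J"
    and C: "C \<subseteq> V" and D: "D \<subseteq> V" and disj: "C \<inter> D = {}"
    and other: "\<And>v. v \<in> V - (C \<union> D) \<Longrightarrow> I v \<inter> M = {}"
    and pa: "\<And>v. v \<in> D \<Longrightarrow> C \<union> (\<Union>a\<in>C. pa a) \<subseteq> pa v"
    and acc: "\<And>v. v \<in> D \<Longrightarrow> (\<Union>a\<in>C. I a) - M \<subseteq> I v"
  obtains d' :: "'u + (('a \<Rightarrow> nat) \<times> ('j \<Rightarrow> 'u) \<Rightarrow> 'j \<Rightarrow> 'u)" and q' K' where
    "latent_repr V pa c (insert j0 J) (\<lambda>v. if v \<in> D then insert j0 (I v - M) else I v) P d' q' K'"
proof -
  let ?E = measure_pmf.expectation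
  define L where "L = J - M"
  \<comment> \<open>Apart from the variables in \<open>M\<close>, the factor \<open>h\<close>
    depends only on the visible values in \<open>X\<close> and the latent values in
    \<open>\<Lambda>\<close>. Hence \<open>ctx\<close> determines \<open>h\<close> as a function of
    \<open>\<mu>\<close>; this is \<open>h_ctx\<close> below.\<close>
  define X where "X = C \<union> (\<Union>a\<in>C. pa a)"
  define \<Lambda> where "\<Lambda> = (\<Union>a\<in>C. I a) - M"
  define ctx where "ctx x u = (restrict x X, restrict u \<Lambda>)" for x :: "'a \<Rightarrow> nat" and u :: "'j \<Rightarrow> 'u"
  define comb where "comb u \<mu> = (\<lambda>j. if j \<in> M then \<mu> j else u j)" for u \<mu> :: "'j \<Rightarrow> 'u"
  define h where "h x u \<mu> = (\<Prod>v\<in>C. pmf (K v x (comb u \<mu>)) (x v))" for x u \<mu>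
  have finJ: "finite (set_pmf (Pi_pmf A d q))" if "A \<subseteq> J" for A
    using that fin rep by (intro finite_set_Pi_pmf) (auto simp: latent_repr_def intro: finite_subset)
  have \<Lambda>: "\<Lambda> \<subseteq> L"
    using I C by (auto simp: \<Lambda>_def L_def)
  have LM: "L \<subseteq> J" "M \<union> L = J" "M \<inter> L = {}"
    using M by (auto simp: L_def)
  have h_ctx: "h (fst (ctx x u)) (snd (ctx x u)) = h x u" for x u
  proof
    fix \<mu>
    show "h (fst (ctx x u)) (snd (ctx x u)) \<mu> = h x u \<mu>"
      unfolding h_def
    proof (intro prod.cong refl)
      fix v assume v: "v \<in> C"
      have "K v (restrict x X) (comb (restrict u \<Lambda>) \<mu>) = K v x (comb u \<mu>)"
        using v C by (intro latent_repr_local[OF rep]) (auto simp: X_def \<Lambda>_def comb_def)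
      then show "pmf (K v (fst (ctx x u)) (comb (snd (ctx x u)) \<mu>)) (fst (ctx x u) v) =
          pmf (K v x (comb u \<mu>)) (x v)"
        using v by (simp add: ctx_def X_def)
    qed
  qed
  have "\<forall>y. \<exists>r. set_pmf r \<subseteq> set_pmf (Pi_pmf M d q) \<and>
      (\<forall>g. ?E (Pi_pmf M d q) (h (fst y) (snd y)) * ?E r g =
        ?E (Pi_pmf M d q) (\<lambda>\<mu>. h (fst y) (snd y) \<mu> * g \<mu>))"
  proof
    fix y
    have "0 \<le> h (fst y) (snd y) \<mu>" for \<mu>
      by (simp add: h_def prod_nonneg)
    then show "\<exists>r. set_pmf r \<subseteq> set_pmf (Pi_pmf M d q) \<and>
      (\<forall>g. ?E (Pi_pmf M d q) (h (fst y) (snd y)) * ?E r g =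
        ?E (Pi_pmf M d q) (\<lambda>\<mu>. h (fst y) (snd y) \<mu> * g \<mu>))"
      by (rule posterior_pmf[OF finJ[OF M], of "h (fst y) (snd y)"]) blast
  qed
  from choice[OF this] obtain R where R_sub: "\<And>y. set_pmf (R y) \<subseteq> set_pmf (Pi_pmf M d q)"
    and R: "\<And>y g. ?E (Pi_pmf M d q) (h (fst y) (snd y)) * ?E (R y) g =
      ?E (Pi_pmf M d q) (\<lambda>\<mu>. h (fst y) (snd y) \<mu> * g \<mu>)"
    by blast
  \<comment> \<open>Only finitely many contexts are attainable. Confining the random function to
    these keeps its support finite, as a latent variable requires; \<open>N\<close> samples the
    posterior independently for each of them.\<close>
  define Y where "Y = (\<lambda>(x, u). ctx x u) ` (assignments V c \<times> set_pmf (Pi_pmf L d q))"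
  have finY: "finite Y"
    unfolding Y_def assignments_def using fin finJ LM by (auto intro!: finite_PiE)
  define N where "N = Pi_pmf Y undefined R"
  have finN: "finite (set_pmf N)"
    unfolding N_def using finY R_sub finJ[OF M] by (intro finite_set_Pi_pmf) (auto intro: finite_subset)
  \<comment> \<open>The tags put the old values (\<open>Inl\<close>) and the random function at
    \<open>j0\<close> (\<open>Inr\<close>) into one type.\<close>
  define q' where "q' j = (if j = j0 then map_pmf Inr N else map_pmf Inl (q j))" for j
  \<comment> \<open>A node of \<open>D\<close> overwrites its \<open>M\<close> coordinates by the
    random function evaluated at the current context. The entry of \<open>projl \<circ> w\<close> at
    \<open>j0\<close> is meaningless, but \<open>j0\<close> is in no \<open>I v\<close> and not in
    \<open>\<Lambda>\<close>.\<close>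
  define K' where "K' v x w = (if v \<in> D
      then K v x (comb (projl \<circ> w) (projr (w j0) (ctx x (projl \<circ> w)))) else K v x (projl \<circ> w))"
    for v x and w :: "'j \<Rightarrow> 'u + (('a \<Rightarrow> nat) \<times> ('j \<Rightarrow> 'u) \<Rightarrow> 'j \<Rightarrow> 'u)"
  have E_J: "?E (Pi_pmf J d q) F = ?E (Pi_pmf L d q) (\<lambda>u. ?E (Pi_pmf M d q) (\<lambda>\<mu>. F (comb u \<mu>)))"
    for F :: "('j \<Rightarrow> 'u) \<Rightarrow> real"
  proof -
    have "Pi_pmf J d q = map_pmf (\<lambda>(\<mu>, u). comb u \<mu>) (pair_pmf (Pi_pmf M d q) (Pi_pmf L d q))"
      using Pi_pmf_union[of M L d q] LM fin finite_subset[OF M] by (simp add: comb_def L_def)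
    then show ?thesis
      by (simp add: expectation_pair_pmf_finite' finJ M LM)
  qed
  have E_insert: "?E (Pi_pmf (insert j0 J) (Inl d) q') F =
      ?E (Pi_pmf J d q) (\<lambda>u. ?E N (\<lambda>\<nu>. F ((Inl \<circ> u)(j0 := Inr \<nu>))))"
    for F :: "('j \<Rightarrow> 'u + (('a \<Rightarrow> nat) \<times> ('j \<Rightarrow> 'u) \<Rightarrow> 'j \<Rightarrow> 'u)) \<Rightarrow> real"
  proof -
    have "Pi_pmf J (Inl d) q' = Pi_pmf J (Inl d) (\<lambda>j. map_pmf Inl (q j))"
      using j0 by (intro Pi_pmf_cong) (auto simp: q'_def)
    also have "\<dots> = map_pmf (\<lambda>u. Inl \<circ> u) (Pi_pmf J d q)"
      using fin by (intro Pi_pmf_map) auto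
    finally have *: "Pi_pmf J (Inl d) q' = map_pmf (\<lambda>u. Inl \<circ> u) (Pi_pmf J d q)" .
    have "q' j0 = map_pmf Inr N"
      by (simp add: q'_def)
    then have "?E (Pi_pmf (insert j0 J) (Inl d) q') F = ?E (pair_pmf (map_pmf Inr N)
        (map_pmf (\<lambda>u. Inl \<circ> u) (Pi_pmf J d q))) (\<lambda>(y, w). F (w(j0 := y)))"
      using fin j0 by (simp add: Pi_pmf_insert * case_prod_beta')
    also have "\<dots> = ?E (Pi_pmf J d q) (\<lambda>u. ?E N (\<lambda>\<nu>. F ((Inl \<circ> u)(j0 := Inr \<nu>))))"
      using finJ[OF order_refl] finN by (subst expectation_pair_pmf_finite') simp_all
    finally show ?thesis .
  qed
  have "latent_repr V pa c (insert j0 J) (\<lambda>v. if v \<in> D then insert j0 (I v - M) else I v) P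
      (Inl d) q' K'"
    unfolding latent_repr_def
  proof (intro conjI ballI allI impI)
    fix j assume "j \<in> insert j0 J"
    then show "finite (set_pmf (q' j))"
      using rep finN by (auto simp: q'_def latent_repr_def)
  next
    fix v and x x' :: "'a \<Rightarrow> nat" and w w' :: "'j \<Rightarrow> 'u + (('a \<Rightarrow> nat) \<times> ('j \<Rightarrow> 'u) \<Rightarrow> 'j \<Rightarrow> 'u)"
    assume v: "v \<in> V" and x: "\<forall>a\<in>pa v. x a = x' a"
      and w: "\<forall>j\<in>if v \<in> D then insert j0 (I v - M) else I v. w j = w' j"
    show "K' v x w = K' v x' w'"
    proof (cases "v \<in> D")
      case True
      \<comment> \<open>By \<open>pa\<close> and \<open>acc\<close>, a node of \<open>D\<close> can
        compute the context from its own parents and its remaining latent variables.\<close>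
      then have "X \<subseteq> pa v" "\<Lambda> \<subseteq> I v - M"
        using pa[of v] acc[of v] unfolding X_def \<Lambda>_def by blast+
      then have "ctx x (projl \<circ> w) = ctx x' (projl \<circ> w')"
        using x w True by (auto simp: ctx_def subset_iff intro!: restrict_ext)
      moreover have "w j0 = w' j0"
        using w True by simp
      ultimately show ?thesis
        using True v x w unfolding K'_def
        by (auto simp: comb_def intro!: latent_repr_local[OF rep])
    next
      case False
      then show ?thesis
        using v x w unfolding K'_def by (auto intro!: latent_repr_local[OF rep])
    qed
  next
    fix x assume x: "x \<in> assignments V c"
    define A where "A u = (\<Prod>v\<in>V - (C \<union> D). pmf (K v x u) (x v))" for u
    define B where "B u \<mu> = (\<Prod>v\<in>D. pmf (K v x (comb u \<mu>)) (x v))" for u \<mu>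
    have split: "prod f V = prod f (V - (C \<union> D)) * prod f C * prod f D" for f :: "'a \<Rightarrow> real"
    proof -
      have "prod f V = prod f (V - (C \<union> D)) * prod f (C \<union> D)"
        using fin C D by (intro prod.subset_diff) auto
      also have "prod f (C \<union> D) = prod f C * prod f D"
        using fin C D disj by (intro prod.union_disjoint) (auto intro: finite_subset)
      finally show ?thesis by (simp add: mult_ac)
    qed
    \<comment> \<open>The remaining nodes read nothing in \<open>M\<close>, so their factor is
      constant in \<open>\<mu>\<close>.\<close>
    have other_eq: "A (comb u \<mu>) = A u" for u \<mu>
      unfolding A_def
    proof (intro prod.cong refl)
      fix v assume "v \<in> V - (C \<union> D)"
      then have "K v x (comb u \<mu>) = K v x u"
        using other[of v] by (intro latent_repr_local[OF rep]) (auto simp: comb_def)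
      then show "pmf (K v x (comb u \<mu>)) (x v) = pmf (K v x u) (x v)" by simp
    qed
    \<comment> \<open>The nodes of \<open>C\<close> still read \<open>\<mu>\<close> while those of
      \<open>D\<close> read the sample, so given \<open>u\<close> the factors \<open>h\<close> and
      \<open>B\<close> are independent.\<close>
    have new: "(\<Prod>v\<in>V. pmf (K' v x ((Inl \<circ> comb u \<mu>)(j0 := Inr \<nu>))) (x v)) =
        A u * (h x u \<mu> * B u (\<nu> (ctx x u)))" for u \<mu> \<nu>
    proof -
      let ?w = "(Inl \<circ> comb u \<mu>)(j0 := Inr \<nu>)"
      have eq: "(projl \<circ> ?w) j = comb u \<mu> j" if "j \<in> J" for j
        using that j0 by auto
      have ctx_eq: "ctx x (projl \<circ> ?w) = ctx x u"
      proof -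
        have "j \<noteq> j0 \<and> j \<notin> M" if "j \<in> \<Lambda>" for j
          using that \<Lambda> LM j0 by blast
        then show ?thesis
          by (auto simp: ctx_def comb_def intro!: restrict_ext)
      qed
      have 1: "K' v x ?w = K v x (comb u \<mu>)" if "v \<in> V - D" for v
      proof -
        have "K v x (projl \<circ> ?w) = K v x (comb u \<mu>)"
        proof (rule latent_repr_local[OF rep])
          fix j assume "j \<in> I v"
          then show "(projl \<circ> ?w) j = comb u \<mu> j"
            using that I[of v] by (intro eq) auto
        qed (use that in simp_all)
        with that show ?thesis by (simp add: K'_def)
      qed
      have 2: "K' v x ?w = K v x (comb u (\<nu> (ctx x u)))" if "v \<in> D" for v
      proof -
        have "K v x (comb (projl \<circ> ?w) (\<nu> (ctx x u))) = K v x (comb u (\<nu> (ctx x u)))"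
        proof (rule latent_repr_local[OF rep])
          fix j assume "j \<in> I v"
          then have "(projl \<circ> ?w) j = comb u \<mu> j"
            using that I[of v] D by (intro eq) auto
          then show "comb (projl \<circ> ?w) (\<nu> (ctx x u)) j = comb u (\<nu> (ctx x u)) j"
            by (simp add: comb_def del: o_apply fun_upd_apply)
        qed (use that D in auto)
        with that show ?thesis
          unfolding K'_def ctx_eq by simp
      qed
      have "(\<Prod>v\<in>V. pmf (K' v x ?w) (x v)) = A (comb u \<mu>) * h x u \<mu> * B u (\<nu> (ctx x u))"
      proof -
        have "v \<in> V - D" if "v \<in> C" for v
          using that C disj by blast
        then show ?thesis
          unfolding split A_def h_def B_def
          by (intro arg_cong2[where f = "(*)"] prod.cong refl) (simp_all add: 1 2)
      qed
      then show ?thesis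
        by (simp add: other_eq)
    qed
    have old: "(\<Prod>v\<in>V. pmf (K v x (comb u \<mu>)) (x v)) = A u * (h x u \<mu> * B u \<mu>)" for u \<mu>
      using other_eq[of u \<mu>] by (simp add: split A_def B_def h_def)
    \<comment> \<open>A single coordinate of \<open>N\<close> has law \<open>R (ctx x u)\<close>.
      Averaging over \<open>\<nu>\<close> thus gives a product of two expectations, which the
      defining identity of the posterior merges into one.\<close>
    have resample: "?E (Pi_pmf M d q) (\<lambda>\<mu>. ?E N (\<lambda>\<nu>. A u * (h x u \<mu> * B u (\<nu> (ctx x u))))) =
        ?E (Pi_pmf M d q) (\<lambda>\<mu>. A u * (h x u \<mu> * B u \<mu>))"
      if u: "u \<in> set_pmf (Pi_pmf L d q)" for u
    proof -
      have "ctx x u \<in> Y"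
        using x u by (auto simp: Y_def)
      then have "map_pmf (\<lambda>\<nu>. \<nu> (ctx x u)) N = R (ctx x u)"
        unfolding N_def using finY by (simp add: Pi_pmf_component)
      then have "?E N (\<lambda>\<nu>. B u (\<nu> (ctx x u))) = ?E (R (ctx x u)) (B u)"
        by (metis integral_map_pmf)
      then have "?E (Pi_pmf M d q) (\<lambda>\<mu>. ?E N (\<lambda>\<nu>. A u * (h x u \<mu> * B u (\<nu> (ctx x u))))) =
          A u * (?E (Pi_pmf M d q) (h x u) * ?E (R (ctx x u)) (B u))"
        by simp
      also have "\<dots> = A u * ?E (Pi_pmf M d q) (\<lambda>\<mu>. h x u \<mu> * B u \<mu>)"
        using R[of "ctx x u" "B u"] by (simp add: h_ctx)
      finally show ?thesis by simp
    qed
    have "pmf P x = ?E (Pi_pmf J d q) (\<lambda>u. \<Prod>v\<in>V. pmf (K v x u) (x v))"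
      using rep x by (simp add: latent_repr_def)
    also have "\<dots> = ?E (Pi_pmf L d q) (\<lambda>u. ?E (Pi_pmf M d q) (\<lambda>\<mu>. A u * (h x u \<mu> * B u \<mu>)))"
      unfolding E_J old ..
    also have "\<dots> = ?E (Pi_pmf L d q) (\<lambda>u. ?E (Pi_pmf M d q) (\<lambda>\<mu>. ?E N
        (\<lambda>\<nu>. A u * (h x u \<mu> * B u (\<nu> (ctx x u))))))"
      \<comment> \<open>Almost everywhere is what is available: for \<open>u\<close> outside the
        support the context may lie outside \<open>Y\<close>.\<close>
      by (intro integral_cong_AE AE_pmfI resample[symmetric]) simp_all
    also have "\<dots> = ?E (Pi_pmf (insert j0 J) (Inl d) q') (\<lambda>w. \<Prod>v\<in>V. pmf (K' v x w) (x v))"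
      unfolding E_insert E_J new ..
    finally show "pmf P x =
        ?E (Pi_pmf (insert j0 J) (Inl d) q') (\<lambda>w. \<Prod>v\<in>V. pmf (K' v x w) (x v))" .
  qed (use rep in \<open>auto simp: latent_repr_def K'_def\<close>)
  then show ?thesis by (rule that)
qed

section \<open>Facets and the canonical pDAG\<close>

lemma facets_superset:
  assumes "finite B" and "A \<in> B"
  obtains F where "F \<in> facets B" and "A \<subseteq> F"
  using finite_has_maximal2[OF assms] by (auto simp: facets_def)

lemma
  assumes "is_mdag \<GG>"
  shows finite_nodes: "finite (pverts (dstruct \<GG>))"
    and finite_faces: "finite (faces \<GG>)"
    and finite_facets: "finite (facets (faces \<GG>))"
proof -
  show "finite (pverts (dstruct \<GG>))"
    using assms by (auto simp: is_mdag_def dag_def intro: pair_fin_digraph.pair_finite_verts)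
  moreover have "faces \<GG> \<subseteq> Pow (pverts (dstruct \<GG>))"
    using assms by (auto simp: is_mdag_def simplicial_complex_def)
  ultimately show "finite (faces \<GG>)"
    using finite_subset by blast
  then show "finite (facets (faces \<GG>))"
    by (auto simp: facets_def)
qed

lemma parents_subset_nodes:
  assumes "is_mdag \<GG>"
  shows "parents (dstruct \<GG>) v \<subseteq> pverts (dstruct \<GG>)"
proof -
  interpret pair_fin_digraph "dstruct \<GG>"
    using assms by (simp add: is_mdag_def dag_def)
  show ?thesis
    by (auto simp: parents_def dest: arc_fst_in_verts)
qed

lemma pverts_can: "pverts (can \<GG>) = pverts (dstruct \<GG>) <+> facets (faces \<GG>)"
  and visible_can: "visible (can \<GG>) = pverts (dstruct \<GG>)"
  and latent_can: "latent (can \<GG>) = facets (faces \<GG>)"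
  and parents_can_Inl: "parents (can \<GG>) (Inl v) =
    Inl ` parents (dstruct \<GG>) v \<union> Inr ` {F \<in> facets (faces \<GG>). v \<in> F}"
  and parents_can_Inr: "parents (can \<GG>) (Inr F) = {}"
  by (auto simp: can_def visible_def latent_def parents_def)

lemma finite_assignments: "finite S \<Longrightarrow> finite (assignments S c)"
  by (auto simp: assignments_def intro: finite_PiE)

lemma restrict_in_assignments:
  assumes "is_mdag \<GG>" and "x \<in> assignments (pverts (dstruct \<GG>)) c"
    and "u \<in> assignments (facets (faces \<GG>)) k"
  shows "restrict (case_sum x u) (parents (can \<GG>) (Inl v)) \<in>
    assignments (parents (can \<GG>) (Inl v)) (case_sum c k)"
  using assms parents_subset_nodes[OF assms(1), of v]
  by (auto simp: assignments_def parents_can_Inl dest: PiE_mem)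

section \<open>Translation between models and kernel representations\<close>

lemma pmf_map_eq_sum:
  fixes q :: "nat pmf"
  assumes "set_pmf q \<subseteq> {..<m}"
  shows "pmf (map_pmf f q) z = (\<Sum>i<m. of_bool (z = f i) * pmf q i)"
proof -
  have "pmf (map_pmf f q) z = measure_pmf.expectation q (\<lambda>i. of_bool (z = f i))"
    by (simp add: map_pmf_def pmf_bind pmf_return indicator_def of_bool_def eq_commute)
  also have "\<dots> = (\<Sum>i<m. of_bool (z = f i) * pmf q i)"
    using assms by (intro integral_measure_pmf_real) auto
  finally show ?thesis .
qed

text \<open>The errors are independent, so the sum over their joint values factors node by node, and
  each factor is the probability that the random map at \<open>a\<close> outputs
  \<open>z a\<close>.\<close>

lemma sum_assignments_prod:
  assumes "finite S" and "\<And>a. a \<in> S \<Longrightarrow> set_pmf (q a) \<subseteq> {..<m a}"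
  shows "(\<Sum>e\<in>assignments S m. \<Prod>a\<in>S. of_bool (z a = f a (e a)) * pmf (q a) (e a)) =
    (\<Prod>a\<in>S. pmf (map_pmf (f a) (q a)) (z a))"
proof -
  have "(\<Prod>a\<in>S. pmf (map_pmf (f a) (q a)) (z a)) =
      (\<Prod>a\<in>S. \<Sum>i<m a. of_bool (z a = f a i) * pmf (q a) i)"
    using assms by (intro prod.cong refl pmf_map_eq_sum)
  also have "\<dots> = (\<Sum>e\<in>assignments S m. \<Prod>a\<in>S. of_bool (z a = f a (e a)) * pmf (q a) (e a))"
    unfolding assignments_def using assms by (intro prod_sum_PiE) auto
  finally show ?thesis ..
qed

lemma expectation_Pi_pmf_eq_sum:
  fixes h :: "('b \<Rightarrow> nat) \<Rightarrow> real"
  assumes "finite L" and "\<And>l. l \<in> L \<Longrightarrow> set_pmf (q l) \<subseteq> {..<k l}"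
  shows "measure_pmf.expectation (Pi_pmf L undefined q) h =
    (\<Sum>u\<in>assignments L k. h u * (\<Prod>l\<in>L. pmf (q l) (u l)))"
proof -
  have "measure_pmf.expectation (Pi_pmf L undefined q) h =
      (\<Sum>u\<in>assignments L k. h u * pmf (Pi_pmf L undefined q) u)"
    using assms by (intro integral_measure_pmf_real finite_assignments)
      (auto simp: set_Pi_pmf PiE_dflt_def assignments_def PiE_iff extensional_def)
  also have "\<dots> = (\<Sum>u\<in>assignments L k. h u * (\<Prod>l\<in>L. pmf (q l) (u l)))"
    using assms by (intro sum.cong refl arg_cong2[where f = "(*)"] pmf_Pi')
      (auto simp: assignments_def PiE_iff extensional_def)
  finally show ?thesis .
qed

text \<open>Summing out the errors turns each structural equation into a kernel. Latent nodes have
  no parents, so their kernels are fixed distributions, whose product is the weight of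
  \<open>u\<close>.\<close>

lemma sum_can_eq_expectation:
  fixes \<GG> :: "'a mdag"
  defines "V \<equiv> pverts (dstruct \<GG>)" and "L \<equiv> facets (faces \<GG>)" and "G \<equiv> can \<GG>"
  assumes \<GG>: "is_mdag \<GG>"
    and q: "\<And>a. a \<in> pverts G \<Longrightarrow> set_pmf (q a) \<subseteq> {..<m a}"
    and Q: "\<And>F. F \<in> L \<Longrightarrow> Q F = map_pmf (f (Inr F) (\<lambda>_. undefined)) (q (Inr F))"
    and k: "\<And>F. F \<in> L \<Longrightarrow> set_pmf (Q F) \<subseteq> {..<k F}"
  shows "(\<Sum>u\<in>assignments (latent G) k. \<Sum>e\<in>assignments (pverts G) m. \<Prod>a\<in>pverts G.
      of_bool (case_sum x u a = f a (restrict (case_sum x u) (parents G a)) (e a))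
        * pmf (q a) (e a)) =
    measure_pmf.expectation (Pi_pmf L undefined Q)
      (\<lambda>u. \<Prod>v\<in>V. pmf (map_pmf
        (f (Inl v) (restrict (case_sum x u) (parents G (Inl v)))) (q (Inl v))) (x v))"
proof -
  have fin: "finite V" "finite L"
    unfolding V_def L_def using \<GG> by (simp_all add: finite_nodes finite_facets)
  have G: "pverts G = V <+> L" "latent G = L" "parents G (Inr F) = {}" for F
    by (simp_all add: G_def V_def L_def pverts_can latent_can parents_can_Inr)
  show ?thesis
    unfolding expectation_Pi_pmf_eq_sum[where q = Q and k = k, OF fin(2) k, simplified] G(2)
    using fin q by (intro sum.cong refl, subst sum_assignments_prod)
      (simp_all add: G prod.Plus Q restrict_def)
qed

lemma mdag_model_latent_repr:
  assumes \<GG>: "is_mdag \<GG>" and P: "P \<in> mdag_model \<GG> c"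
    and pos: "\<And>v. v \<in> pverts (dstruct \<GG>) \<Longrightarrow> 0 < c v"
  obtains q K where "latent_repr (pverts (dstruct \<GG>)) (parents (dstruct \<GG>)) c (facets (faces \<GG>))
    (\<lambda>v. {F \<in> facets (faces \<GG>). v \<in> F}) P (undefined :: nat) q K"
proof -
  let ?V = "pverts (dstruct \<GG>)" and ?L = "facets (faces \<GG>)" and ?G = "can \<GG>"
  from P obtain k m q f where supp: "set_pmf P \<subseteq> assignments ?V c"
    and q: "\<And>a. a \<in> pverts ?G \<Longrightarrow> set_pmf (q a) \<subseteq> {..<m a}"
    and f: "\<And>a y e. \<lbrakk>a \<in> pverts ?G; y \<in> assignments (parents ?G a) (case_sum c k); e < m a\<rbrakk> \<Longrightarrow>
      f a y e < case_sum c k a"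
    and eq: "\<And>x. x \<in> assignments ?V c \<Longrightarrow> pmf P x =
      (\<Sum>u\<in>assignments (latent ?G) k. \<Sum>e\<in>assignments (pverts ?G) m. \<Prod>a\<in>pverts ?G.
        of_bool (case_sum x u a = f a (restrict (case_sum x u) (parents ?G a)) (e a))
          * pmf (q a) (e a))"
    unfolding mdag_model_def pdag_model_def visible_can by blast
  \<comment> \<open>\<open>\<lambda>_. undefined\<close> is the only assignment to the empty set of
    parents of a latent node.\<close>
  define Q where "Q F = map_pmf (f (Inr F) (\<lambda>_. undefined)) (q (Inr F))" for F
  define y where "y v x u = restrict (case_sum x u) (parents ?G (Inl v))"
    for v and x :: "'a \<Rightarrow> nat" and u :: "'a set \<Rightarrow> nat"
  \<comment> \<open>The bound on \<open>f\<close> holds for assignments in range, whereas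
    \<open>latent_repr\<close> bounds the kernel for all arguments. The fallback \<open>0\<close> is
    a legal value because \<open>c v\<close> is positive.\<close>
  define K where "K v x u =
    (if y v x u \<in> assignments (parents ?G (Inl v)) (case_sum c k)
     then map_pmf (f (Inl v) (y v x u)) (q (Inl v)) else return_pmf 0)" for v x u
  have fin: "finite ?L"
    using \<GG> by (rule finite_facets)
  have Q: "set_pmf (Q F) \<subseteq> {..<k F}" if "F \<in> ?L" for F
    using that q[of "Inr F"] f[of "Inr F" "\<lambda>_. undefined"]
    by (fastforce simp: Q_def pverts_can parents_can_Inr assignments_def)
  have "latent_repr ?V (parents (dstruct \<GG>)) c ?L (\<lambda>v. {F \<in> ?L. v \<in> F}) P undefined Q K"
    unfolding latent_repr_def
  proof (intro conjI ballI allI impI)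
    fix F assume "F \<in> ?L"
    then show "finite (set_pmf (Q F))"
      using Q finite_subset by blast
  next
    fix v x u assume v: "v \<in> ?V"
    have "f (Inl v) (y v x u) e < c v"
      if "y v x u \<in> assignments (parents ?G (Inl v)) (case_sum c k)" and "e \<in> set_pmf (q (Inl v))"
      for e
    proof -
      have "Inl v \<in> pverts ?G"
        using v by (simp add: pverts_can InlI)
      then show ?thesis
        using that q f[of "Inl v" "y v x u" e] by auto
    qed
    then show "set_pmf (K v x u) \<subseteq> {..<c v}"
      using pos[OF v] by (auto simp: K_def)
  next
    fix v and x x' :: "'a \<Rightarrow> nat" and u u' :: "'a set \<Rightarrow> nat"
    assume "\<forall>w\<in>parents (dstruct \<GG>) v. x w = x' w"
      and "\<forall>j\<in>{F \<in> ?L. v \<in> F}. u j = u' j"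
    then have "y v x u = y v x' u'"
      by (auto simp: y_def parents_can_Inl intro!: restrict_ext)
    then show "K v x u = K v x' u'"
      by (simp add: K_def)
  next
    fix x assume x: "x \<in> assignments ?V c"
    have "pmf P x = measure_pmf.expectation (Pi_pmf ?L undefined Q)
        (\<lambda>u. \<Prod>v\<in>?V. pmf (map_pmf (f (Inl v) (y v x u)) (q (Inl v))) (x v))"
      unfolding eq[OF x] y_def Q_def
      using \<GG> q Q by (intro sum_can_eq_expectation) (auto simp: Q_def)
    \<comment> \<open>For \<open>u\<close> in the support all values are in range, so the fallback
      is not taken.\<close>
    also have "\<dots> = measure_pmf.expectation (Pi_pmf ?L undefined Q) (\<lambda>u. \<Prod>v\<in>?V. pmf (K v x u) (x v))"
    proof (intro integral_cong_AE)
      show "AE u in measure_pmf (Pi_pmf ?L undefined Q).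
          (\<Prod>v\<in>?V. pmf (map_pmf (f (Inl v) (y v x u)) (q (Inl v))) (x v)) =
          (\<Prod>v\<in>?V. pmf (K v x u) (x v))"
      proof (intro AE_pmfI)
        fix u assume "u \<in> set_pmf (Pi_pmf ?L undefined Q)"
        then have "u \<in> assignments ?L k"
          using fin Q by (auto simp: set_Pi_pmf PiE_dflt_def assignments_def PiE_iff extensional_def)
        then show "(\<Prod>v\<in>?V. pmf (map_pmf (f (Inl v) (y v x u)) (q (Inl v))) (x v)) =
            (\<Prod>v\<in>?V. pmf (K v x u) (x v))"
          using restrict_in_assignments[OF \<GG> x, of u k] by (simp add: K_def y_def)
      qed
    qed auto
    finally show "pmf P x =
        measure_pmf.expectation (Pi_pmf ?L undefined Q) (\<lambda>u. \<Prod>v\<in>?V. pmf (K v x u) (x v))" .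
  qed (rule supp)
  then show ?thesis by (rule that)
qed

text \<open>
  Conversely, the error variable of \<open>v\<close> is a random function that draws an independent value from the
  kernel for every assignment of the parents of \<open>v\<close>. All values are encoded as natural numbers.
\<close>

lemma latent_repr_mdag_model:
  fixes d :: 'u
  assumes \<GG>: "is_mdag \<GG>"
    and rep: "latent_repr (pverts (dstruct \<GG>)) (parents (dstruct \<GG>)) c (facets (faces \<GG>))
      (\<lambda>v. {F \<in> facets (faces \<GG>). v \<in> F}) P d q K"
  shows "P \<in> mdag_model \<GG> c"
proof -
  let ?V = "pverts (dstruct \<GG>)" and ?L = "facets (faces \<GG>)" and ?G = "can \<GG>"
  let ?E = measure_pmf.expectation
  have fin: "finite ?V" "finite ?L"
    using \<GG> by (simp_all add: finite_nodes finite_facets)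
  have K: "set_pmf (K v x u) \<subseteq> {..<c v}" if "v \<in> ?V" for v x u
    using rep that by (simp add: latent_repr_def)
  \<comment> \<open>A common finite set of values for all latent variables; enumerating it encodes
    them as numbers below \<open>card U\<close>.\<close>
  define U where "U = (\<Union>F\<in>?L. set_pmf (q F))"
  have U: "finite U"
    using rep fin by (auto simp: U_def latent_repr_def)
  define k :: "'a set \<Rightarrow> nat" where "k F = card U" for F
  define Q where "Q F = map_pmf (to_nat_on U) (q F)" for F
  have Q_sub: "set_pmf (Q F) \<subseteq> {..<k F}" if "F \<in> ?L" for F
    using that bij_betw_imp_surj_on[OF to_nat_on_finite[OF U]] by (auto simp: Q_def k_def U_def)
  have q_Q: "q F = bind_pmf (Q F) (\<lambda>i. return_pmf (from_nat_into U i))" if "F \<in> ?L" for F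
  proof -
    have "map_pmf (\<lambda>a. from_nat_into U (to_nat_on U a)) (q F) = map_pmf id (q F)"
    proof (intro map_pmf_cong refl)
      fix a assume "a \<in> set_pmf (q F)"
      then have "a \<in> U"
        using that by (auto simp: U_def)
      then show "from_nat_into U (to_nat_on U a) = id a"
        using U by (simp add: countable_finite)
    qed
    then show ?thesis
      by (simp add: Q_def pmf.map_comp o_def flip: map_pmf_def)
  qed
  define Y where "Y v = assignments (parents ?G (Inl v)) (case_sum c k)" for v
  have finY: "finite (Y v)" for v
    unfolding Y_def using finite_subset[OF parents_subset_nodes[OF \<GG>] fin(1)] fin(2)
    by (intro finite_assignments) (simp add: parents_can_Inl)
  \<comment> \<open>The kernel as seen in the canonical pDAG: visible parents are read through
    \<open>Inl\<close>, latent ones are read through \<open>Inr\<close> and decoded.\<close>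
  define \<kappa> where "\<kappa> v y = K v (y \<circ> Inl) (\<lambda>F. from_nat_into U (y (Inr F)))" for v y
  define T where "T v = Pi_pmf (Y v) 0 (\<kappa> v)" for v
  have finT: "finite (set_pmf (T v))" if "v \<in> ?V" for v
    unfolding T_def using K[OF that] finY
    by (intro finite_set_Pi_pmf) (auto simp: \<kappa>_def intro: finite_subset)
  define m where "m = case_sum (\<lambda>v. card (set_pmf (T v))) k"
  define q' where "q' = case_sum (\<lambda>v. map_pmf (to_nat_on (set_pmf (T v))) (T v)) Q"
  \<comment> \<open>At a visible node the error is the code of a response function, which is decoded
    and applied to \<open>y\<close>; at a latent node it is the value itself.\<close>
  define f :: "'a + 'a set \<Rightarrow> ('a + 'a set \<Rightarrow> nat) \<Rightarrow> nat \<Rightarrow> nat"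
    where "f = case_sum (\<lambda>v y i. from_nat_into (set_pmf (T v)) i y) (\<lambda>F y i. i)"
  have q': "set_pmf (q' a) \<subseteq> {..<m a}" if "a \<in> pverts ?G" for a
  proof (cases a)
    case (Inl v)
    then have "v \<in> ?V"
      using that by (auto simp: pverts_can)
    then show ?thesis
      using bij_betw_imp_surj_on[OF to_nat_on_finite[OF finT]] by (simp add: Inl q'_def m_def)
  next
    case (Inr F)
    then have "F \<in> ?L"
      using that by (auto simp: pverts_can)
    then show ?thesis
      using Q_sub by (simp add: Inr q'_def m_def)
  qed
  have f_bound: "f a y e < case_sum c k a"
    if "a \<in> pverts ?G" and "y \<in> assignments (parents ?G a) (case_sum c k)" and "e < m a" for a y e
  proof (cases a)
    case (Inl v)
    have "from_nat_into (set_pmf (T v)) e \<in> set_pmf (T v)"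
      by (intro from_nat_into set_pmf_not_empty)
    then have "from_nat_into (set_pmf (T v)) e y \<in> set_pmf (\<kappa> v y)"
      using that finY by (auto simp: Inl T_def Y_def set_Pi_pmf PiE_dflt_def)
    then show ?thesis
      using K[of v] that by (auto simp: Inl \<kappa>_def f_def pverts_can)
  qed (use that in \<open>simp add: f_def m_def\<close>)
  have kernel: "map_pmf (f (Inl v) y) (q' (Inl v)) = \<kappa> v y" if "v \<in> ?V" "y \<in> Y v" for v y
  proof -
    have "map_pmf (f (Inl v) y) (q' (Inl v)) = map_pmf (\<lambda>r. r y) (T v)"
      using finT[OF that(1)]
      by (auto simp: f_def q'_def pmf.map_comp countable_finite intro!: map_pmf_cong)
    also have "\<dots> = \<kappa> v y"
      using that finY by (simp add: T_def Pi_pmf_component)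
    finally show ?thesis .
  qed
  have "pmf P x = (\<Sum>u\<in>assignments (latent ?G) k. \<Sum>e\<in>assignments (pverts ?G) m. \<Prod>a\<in>pverts ?G.
        of_bool (case_sum x u a = f a (restrict (case_sum x u) (parents ?G a)) (e a))
          * pmf (q' a) (e a))" if x: "x \<in> assignments ?V c" for x
  proof -
    let ?y = "\<lambda>v u. restrict (case_sum x u) (parents ?G (Inl v))"
    have "Pi_pmf ?L d q = Pi_pmf ?L d (\<lambda>F. bind_pmf (Q F) (\<lambda>i. return_pmf (from_nat_into U i)))"
      using q_Q by (intro Pi_pmf_cong) auto
    also have "\<dots> = map_pmf (\<lambda>u F. if F \<in> ?L then from_nat_into U (u F) else d) (Pi_pmf ?L undefined Q)"
      using fin by (simp add: Pi_pmf_bind[where d' = undefined] map_pmf_def)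
    finally have Pi_q: "Pi_pmf ?L d q =
      map_pmf (\<lambda>u F. if F \<in> ?L then from_nat_into U (u F) else d) (Pi_pmf ?L undefined Q)" .
    have "pmf P x = ?E (Pi_pmf ?L d q) (\<lambda>u. \<Prod>v\<in>?V. pmf (K v x u) (x v))"
      using rep x by (simp add: latent_repr_def)
    also have "\<dots> = ?E (Pi_pmf ?L undefined Q) (\<lambda>u. \<Prod>v\<in>?V.
        pmf (K v x (\<lambda>F. if F \<in> ?L then from_nat_into U (u F) else d)) (x v))"
      by (simp add: Pi_q)
    also have "\<dots> = ?E (Pi_pmf ?L undefined Q) (\<lambda>u. \<Prod>v\<in>?V.
        pmf (map_pmf (f (Inl v) (?y v u)) (q' (Inl v))) (x v))"
    proof (intro integral_cong_AE AE_pmfI prod.cong refl)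
      fix u v assume "u \<in> set_pmf (Pi_pmf ?L undefined Q)" and v: "v \<in> ?V"
      then have "u \<in> assignments ?L k"
        using fin Q_sub
        by (auto simp: set_Pi_pmf PiE_dflt_def assignments_def PiE_iff extensional_def)
      then have "?y v u \<in> Y v"
        unfolding Y_def using \<GG> x by (intro restrict_in_assignments)
      moreover have "K v x (\<lambda>F. if F \<in> ?L then from_nat_into U (u F) else d) = \<kappa> v (?y v u)"
        unfolding \<kappa>_def using v by (intro latent_repr_local[OF rep]) (auto simp: parents_can_Inl)
      ultimately show "pmf (K v x (\<lambda>F. if F \<in> ?L then from_nat_into U (u F) else d)) (x v) =
          pmf (map_pmf (f (Inl v) (?y v u)) (q' (Inl v))) (x v)"
        using v by (simp add: kernel)
    qed auto
    also have "\<dots> = (\<Sum>u\<in>assignments (latent ?G) k. \<Sum>e\<in>assignments (pverts ?G) m. \<Prod>a\<in>pverts ?G.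
        of_bool (case_sum x u a = f a (restrict (case_sum x u) (parents ?G a)) (e a))
          * pmf (q' a) (e a))"
      using Q_sub by (intro sum_can_eq_expectation[OF \<GG> q', symmetric]) (simp_all add: f_def q'_def)
    finally show ?thesis .
  qed
  moreover have "set_pmf P \<subseteq> assignments ?V c"
    using rep by (simp add: latent_repr_def)
  ultimately show ?thesis
    unfolding mdag_model_def pdag_model_def visible_can using q' f_bound by blast
qed

section \<open>Inclusions between mDAG models\<close>

text \<open>Every facet \<open>F\<close> of the smaller complex lies in a facet \<open>g F\<close>
  of the larger one, whose latent variable can carry that of \<open>F\<close>.\<close>

lemma mdag_model_mono:
  assumes \<GG>: "is_mdag \<GG>" and \<GG>': "is_mdag \<GG>'"
    and same: "dstruct \<GG>' = dstruct \<GG>" and sub: "faces \<GG> \<subseteq> faces \<GG>'"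
    and pos: "\<And>v. v \<in> pverts (dstruct \<GG>) \<Longrightarrow> 0 < c v"
  shows "mdag_model \<GG> c \<subseteq> mdag_model \<GG>' c"
proof
  fix P assume "P \<in> mdag_model \<GG> c"
  then obtain q K where rep: "latent_repr (pverts (dstruct \<GG>)) (parents (dstruct \<GG>)) c
      (facets (faces \<GG>)) (\<lambda>v. {F \<in> facets (faces \<GG>). v \<in> F}) P (undefined :: nat) q K"
    using mdag_model_latent_repr[of \<GG> P c] \<GG> pos by blast
  have "\<forall>F\<in>facets (faces \<GG>). \<exists>F'. F' \<in> facets (faces \<GG>') \<and> F \<subseteq> F'"
  proof
    fix F assume "F \<in> facets (faces \<GG>)"
    then have "F \<in> faces \<GG>'"
      using sub by (auto simp: facets_def)
    then show "\<exists>F'. F' \<in> facets (faces \<GG>') \<and> F \<subseteq> F'"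
      using facets_superset[OF finite_faces[OF \<GG>']] by metis
  qed
  then obtain g where g: "\<And>F. F \<in> facets (faces \<GG>) \<Longrightarrow> g F \<in> facets (faces \<GG>') \<and> F \<subseteq> g F"
    by metis
  have "latent_repr (pverts (dstruct \<GG>)) (parents (dstruct \<GG>)) c
      (facets (faces \<GG>')) (\<lambda>v. {F \<in> facets (faces \<GG>'). v \<in> F}) P undefined
      (\<lambda>F'. Pi_pmf {F \<in> facets (faces \<GG>). g F = F'} undefined q) (\<lambda>v x w. K v x (\<lambda>F. w (g F) F))"
    using g by (intro latent_repr_reassign[OF rep] finite_facets \<GG> \<GG>') auto
  then show "P \<in> mdag_model \<GG>' c"
    by (rule latent_repr_mdag_model[OF \<GG>', unfolded same])
qed

text \<open>Once \<open>latent_repr_posterior\<close> has withdrawn the latent variables of the new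
  facets from \<open>D\<close>, the readers of each latent variable lie in a face of
  \<open>\<GG>\<close>, so a facet above that face can carry it.\<close>

lemma mdag_model_add_faces_subset:
  fixes \<GG> :: "'a mdag" and \<C> :: "'a set set" and D :: "'a set"
  assumes \<GG>: "is_mdag \<GG>"
    and \<C>: "\<C> \<subseteq> faces \<GG>" and D: "D \<in> faces \<GG>"
    and disj: "\<And>C. C \<in> \<C> \<Longrightarrow> D \<inter> C = {}"
    and pa: "\<And>C d. \<lbrakk>C \<in> \<C>; d \<in> D\<rbrakk> \<Longrightarrow>
      parents_of (dstruct \<GG>) C \<union> C \<subseteq> parents (dstruct \<GG>) d"
    and facet: "\<And>B. \<lbrakk>B \<in> facets (faces \<GG>); \<And>C. C \<in> \<C> \<Longrightarrow> \<not> B \<subseteq> C; B \<inter> \<Union>\<C> \<noteq> {}\<rbrakk> \<Longrightarrow> D \<subseteq> B"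
    and pos: "\<And>v. v \<in> pverts (dstruct \<GG>) \<Longrightarrow> 0 < c v"
  shows "mdag_model (add_faces \<GG> ((\<lambda>C. C \<union> D) ` \<C>)) c \<subseteq> mdag_model \<GG> c"
proof
  let ?\<GG>' = "add_faces \<GG> ((\<lambda>C. C \<union> D) ` \<C>)"
  let ?V = "pverts (dstruct \<GG>)" and ?pa = "parents (dstruct \<GG>)"
  let ?L = "facets (faces \<GG>)" and ?L' = "facets (faces ?\<GG>')"
  let ?I' = "\<lambda>v. Some ` {F \<in> ?L'. v \<in> F}"
  have face_nodes: "A \<subseteq> ?V" if "A \<in> faces \<GG>" for A
    using that \<GG> by (auto simp: is_mdag_def simplicial_complex_def)
  have \<GG>': "is_mdag ?\<GG>'"
    using \<C> D face_nodes by (intro is_mdag_add_faces \<GG>) blast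
  have [simp]: "dstruct ?\<GG>' = dstruct \<GG>"
    by (simp add: add_faces_def)
  fix P assume "P \<in> mdag_model ?\<GG>' c"
  then obtain q\<^sub>0 K\<^sub>0 where rep\<^sub>0: "latent_repr ?V ?pa c ?L' (\<lambda>v. {F \<in> ?L'. v \<in> F}) P (undefined :: nat) q\<^sub>0 K\<^sub>0"
    using mdag_model_latent_repr[OF \<GG>', of P c] pos by auto
  have fin: "finite ?L" "finite ?L'"
    using finite_facets \<GG> \<GG>' by blast+
  \<comment> \<open>Labelling by \<open>Some\<close> frees the index \<open>None\<close> for the new
    variable shared by \<open>D\<close>.\<close>
  have rep: "latent_repr ?V ?pa c (Some ` ?L') ?I' P undefined
      (\<lambda>j. Pi_pmf {F \<in> ?L'. Some F = j} undefined q\<^sub>0) (\<lambda>v x w. K\<^sub>0 v x (\<lambda>F. w (Some F) F))"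
    using fin by (intro latent_repr_reassign[OF rep\<^sub>0]) auto
  define M where "M = Some ` {F \<in> ?L'. F \<in> (\<lambda>C. C \<union> D) ` \<C>}"
  \<comment> \<open>\<open>C \<union> D\<close> is a face of the enlarged complex, so a facet
    \<open>F\<close> inside it equals it and belongs to \<open>M\<close>. Any other facet must
    already be a facet of \<open>\<GG>\<close>.\<close>
  have old_facet: "F \<in> ?L \<and> (\<forall>C\<in>\<C>. \<not> F \<subseteq> C)" if "F \<in> ?L'" "Some F \<notin> M" for F
  proof -
    have F: "F \<notin> (\<lambda>C. C \<union> D) ` \<C>"
      using that by (auto simp: M_def)
    have "\<not> F \<subseteq> C \<union> D" if "C \<in> \<C>" for C
      using F that \<open>F \<in> ?L'\<close> by (auto simp: facets_def add_faces_def)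
    then show ?thesis
      using \<open>F \<in> ?L'\<close> by (fastforce simp: facets_def add_faces_def)
  qed
  have shared: "D \<subseteq> F" if "F \<in> ?L'" "Some F \<notin> M" "F \<inter> \<Union>\<C> \<noteq> {}" for F
    using old_facet[OF that(1,2)] that(3) by (intro facet) auto
  obtain d :: "('a set \<Rightarrow> nat) + (('a \<Rightarrow> nat) \<times> ('a set option \<Rightarrow> 'a set \<Rightarrow> nat) \<Rightarrow>
      'a set option \<Rightarrow> 'a set \<Rightarrow> nat)"
    and q K where rep': "latent_repr ?V ?pa c (insert None (Some ` ?L'))
      (\<lambda>v. if v \<in> D then insert None (?I' v - M) else ?I' v) P d q K"
  proof (rule latent_repr_posterior[OF rep, of None M "\<Union>\<C>" D])
    show "\<Union>\<C> \<subseteq> ?V" "D \<subseteq> ?V"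
      using \<C> D face_nodes by blast+
    show "\<Union>\<C> \<inter> D = {}"
      using disj by blast
    show "?I' v \<inter> M = {}" if "v \<in> ?V - (\<Union>\<C> \<union> D)" for v
      using that by (auto simp: M_def)
    show "\<Union>\<C> \<union> (\<Union>a\<in>\<Union>\<C>. ?pa a) \<subseteq> ?pa v" if "v \<in> D" for v
      using pa[OF _ that] by (auto simp: parents_of_def)
    show "(\<Union>a\<in>\<Union>\<C>. ?I' a) - M \<subseteq> ?I' v" if "v \<in> D" for v
      using shared that by blast
    show "finite ?V" "finite (Some ` ?L')" "?I' v \<subseteq> Some ` ?L'" "None \<notin> Some ` ?L'"
      "M \<subseteq> Some ` ?L'" for v
      using \<GG> fin by (auto simp: M_def finite_nodes)
  qed (rule that)
  have "\<exists>F'. F' \<in> ?L \<and> A \<subseteq> F'" if "A \<in> faces \<GG>" for A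
    using facets_superset[OF finite_faces[OF \<GG>] that] by blast
  then obtain up where up: "\<And>A. A \<in> faces \<GG> \<Longrightarrow> up A \<in> ?L \<and> A \<subseteq> up A"
    by metis
  \<comment> \<open>The shared variable goes to a facet above \<open>D\<close>, a variable of
    \<open>M\<close> to a facet above \<open>F - D\<close>, which is some \<open>C\<close> in
    \<open>\<C>\<close> by disjointness, and every other variable stays in its old facet.\<close>
  define g where "g j = (case j of None \<Rightarrow> up D
    | Some F \<Rightarrow> if j \<in> M then up (F - D) else F)" for j
  have M_face: "F - D \<in> faces \<GG>" if "Some F \<in> M" for F
    using that \<C> disj by (auto simp: M_def Un_Diff Diff_triv Int_commute)
  have g_L: "g ` insert None (Some ` ?L') \<subseteq> ?L"
    using up[OF D] up M_face old_facet by (auto simp: g_def)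
  \<comment> \<open>The nodes that still read a variable of \<open>M\<close> lie outside
    \<open>D\<close>, so the smaller facet contains them.\<close>
  have "v \<in> up (F - D)" if "Some F \<in> M" "v \<in> F" "v \<notin> D" for v F
    using up[OF M_face[OF that(1)]] that by blast
  then have "v \<in> g j" if "j \<in> (if v \<in> D then insert None (?I' v - M) else ?I' v)" for v j
    using that up[OF D] by (auto simp: g_def split: if_splits)
  then have "latent_repr ?V ?pa c ?L (\<lambda>v. {F \<in> ?L. v \<in> F}) P undefined
      (\<lambda>F. Pi_pmf {j \<in> insert None (Some ` ?L'). g j = F} d q) (\<lambda>v x w. K v x (\<lambda>j. w (g j) j))"
    using fin g_L by (intro latent_repr_reassign[OF rep']) (auto split: if_splits)
  then show "P \<in> mdag_model \<GG> c"
    by (rule latent_repr_mdag_model[OF \<GG>])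
qed

theorem proposition8:
  fixes \<GG> \<GG>' :: "'a mdag" and C :: "nat \<Rightarrow> 'a set" and D :: "'a set" and n :: nat
  assumes "is_mdag \<GG>"
    and "\<forall>i\<in>{1..n}. C i \<in> faces \<GG>"
    and "D \<in> faces \<GG>"
    and "\<forall>i\<in>{1..n}. D \<inter> C i = {}"
    and "\<GG>' = add_faces \<GG> ((\<lambda>i. C i \<union> D) ` {1..n})"
    and "\<forall>i\<in>{1..n}. \<forall>d\<in>D.
      parents_of (dstruct \<GG>) (C i) \<union> C i \<subseteq> parents (dstruct \<GG>) d"
    and "\<forall>B'\<in>facets (faces \<GG>). (\<forall>i\<in>{1..n}. \<not> B' \<subseteq> C i) \<longrightarrow>
      (\<exists>c\<in>(\<Union>i\<in>{1..n}. C i). c \<in> B') \<longrightarrow> D \<subseteq> B'"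
  shows "\<GG> \<succeq> \<GG>' \<and> struct_dominates \<GG>' \<GG> \<and> \<GG> \<cong>\<^sub>o \<GG>'"
proof -
  have \<GG>'_eq: "\<GG>' = add_faces \<GG> ((\<lambda>A. A \<union> D) ` C ` {1..n})"
    using assms(5) by (simp add: image_image)
  have same: "dstruct \<GG>' = dstruct \<GG>" and sub: "faces \<GG> \<subseteq> faces \<GG>'"
    by (auto simp: \<GG>'_eq add_faces_def)
  have nodes: "A \<subseteq> pverts (dstruct \<GG>)" if "A \<in> faces \<GG>" for A
    using that assms(1) by (simp add: is_mdag_def simplicial_complex_def)
  have \<GG>': "is_mdag \<GG>'"
    unfolding assms(5)
  proof (rule is_mdag_add_faces[OF assms(1)])
    show "A \<subseteq> pverts (dstruct \<GG>)" if "A \<in> (\<lambda>i. C i \<union> D) ` {1..n}" for A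
      using that assms(2,3) nodes by blast
  qed
  have dom: "mdag_model \<GG>' c \<subseteq> mdag_model \<GG> c" if pos: "\<forall>v\<in>pverts (dstruct \<GG>). 0 < c v" for c
    unfolding \<GG>'_eq
  proof (rule mdag_model_add_faces_subset[OF assms(1)])
    show "D \<subseteq> B" if "B \<in> facets (faces \<GG>)" "\<And>A. A \<in> C ` {1..n} \<Longrightarrow> \<not> B \<subseteq> A"
      "B \<inter> \<Union> (C ` {1..n}) \<noteq> {}" for B
      using assms(7) that by blast
    show "D \<inter> A = {}" if "A \<in> C ` {1..n}" for A
      using assms(4) that by blast
    show "parents_of (dstruct \<GG>) A \<union> A \<subseteq> parents (dstruct \<GG>) d"
      if "A \<in> C ` {1..n}" "d \<in> D" for A d
      using assms(6) that by blast
  qed (use assms(2,3) pos in blast)+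
  \<comment> \<open>The converse inclusion is monotonicity, as the complex only grows.\<close>
  have "mdag_model \<GG> c = mdag_model \<GG>' c" if "\<forall>v\<in>pverts (dstruct \<GG>). 0 < c v" for c
    using dom[OF that] mdag_model_mono[OF assms(1) \<GG>' same sub, of c] that by blast
  with dom same sub show ?thesis
    by (simp add: obs_dominates_def obs_equivalent_def struct_dominates_def)
qed

end
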